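(* Let $a\in\mathbb{R}$, $n\in\mathbb{Z}_+$, $\alpha\in(n-1,n)$, $\lambda\in\mathbb{R}\setminus\{1\}$, and let $x:\mathbb{N}_{a-n+1}\to\mathbb{R}$ be such that its nabla Laplace transform converges for $|s-1|<r$, where $r>0$. Then for all $s\in\mathbb{C}$ with $|s-1|<\min\{r,|1-\lambda|\}$: $$\mathscr{N}_a\{\nabla^{n,\lambda}x(k)\}=\Bigl(\frac{s-\lambda}{1-\lambda}\Bigr)^{n}\mathscr{N}_a\{x(k)\}-\frac{1}{1-\lambda}\sum_{i=0}^{n-1}\Bigl(\frac{s-\lambda}{1-\lambda}\Bigr)^{i}\bigl[\nabla^{n-i-1,\lambda}x(k)\bigr]_{k=a},$$ $$\mathscr{N}_a\{\nabla^{n,\lambda}x(k)\}=\Bigl(\frac{s-\lambda}{1-\lambda}\Bigr)^{n}\mathscr{N}_a\{x(k)\}-\frac{1}{1-\lambda}\sum_{i=0}^{n-1}\Bigl(\frac{s-\lambda}{1-\lambda}\Bigr)^{n-i-1}\bigl[\nabla^{i,\lambda}x(k)\bigr]_{k=a},$$ $$\mathscr{N}_a\{{}_a^{\rm R}\nabla_k^{\alpha,\lambda}x(k)\}=\Bigl(\frac{s-\lambda}{1-\lambda}\Bigr)^{\alpha}\mathscr{N}_a\{x(k)\}-\frac{1}{1-\lambda}\sum_{i=0}^{n-1}\Bigl(\frac{s-\lambda}{1-\lambda}\Bigr)^{i}\bigl[{}_a^{\rm R}\nabla_k^{\alpha-i-1,\lambda}x(k)\bigr]_{k=a},$$ $$\mathscr{N}_a\{{}_a^{\rm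 C}\nabla_k^{\alpha,\lambda}x(k)\}=\Bigl(\frac{s-\lambda}{1-\lambda}\Bigr)^{\alpha}\mathscr{N}_a\{x(k)\}-\frac{1}{1-\lambda}\sum_{i=0}^{n-1}\Bigl(\frac{s-\lambda}{1-\lambda}\Bigr)^{\alpha-i-1}\bigl[\nabla^{i,\lambda}x(k)\bigr]_{k=a}.$$
   Context: For $b\in\mathbb{R}$, $\mathbb{N}_b=\{b,b+1,b+2,\dots\}$; $\mathbb{Z}_+=\{1,2,\dots\}$. $\binom{p}{i}=\frac{p(p-1)\cdots(p-i+1)}{i!}$ for real $p$ and integer $i\ge 0$. Nabla Laplace transform: $\mathscr{N}_a\{x(k)\}=\sum_{j=1}^{+\infty}(1-s)^{j-1}x(j+a)$, a function of $s\in\mathbb{C}$ (only values on $\mathbb{N}_{a+1}$ enter). Nabla difference: $\nabla^n z(k)=\sum_{i=0}^n(-1)^i\binom{n}{i}z(k-i)$, with $\nabla^0 z=z$. Grünwald–Letnikov difference/sum of order $\alpha\in\mathbb{R}$: ${}_a^{\rm G}\nabla_k^\alpha z(k)=\sum_{i=0}^{k-a-1}(-1)^i\binom{\alpha}{i}z(k-i)$; empty sums are $0$, so this equals $0$ at $k=a,a-1,\dots$. For $\alpha\in(n-1,n)$, Riemann–Liouville: ${}_a^{\rm R}\nabla_k^\alpha z(k)=\nabla^n\,{}_a^{\rm G}\nabla_k^{\alpha-n}z(k)$; Caputo: ${}_a^{\rm C}\nabla_k^\alpha z(k)={}_a^{\rm G}\nabla_k^{\alpha-n}\nabla^n z(k)$.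 For $0\le i\le n-1$, ${}_a^{\rm R}\nabla_k^{\alpha-i-1}z(k)=\nabla^{n-i-1}{}_a^{\rm G}\nabla_k^{\alpha-n}z(k)$; in particular for $i=n-1$ it means ${}_a^{\rm G}\nabla_k^{\alpha-n}z(k)$. Tempered versions with tempered function $w(k)=(1-\lambda)^{k-a}$: for each operator $D$ above, the operator written with the extra superscript $\lambda$ sends $x$ to $(1-\lambda)^{-(k-a)}D\bigl[(1-\lambda)^{k-a}x(k)\bigr]$. $[\,\cdot\,]_{k=a}$ denotes evaluation at $k=a$. Complex powers are principal values (on the stated region $\left|\frac{s-\lambda}{1-\lambda}-1\right|<1$). *)

theory Defs
  imports "HOL-Analysis.Analysis"
begin

text \<open>
  A function on \<open>\<nat>\<^sub>b = {b, b + 1, \<dots>}\<close> is represented by a total function on the reals; the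
  operators below, evaluated at points of \<open>a + \<int>\<close>, look only at its values on \<open>a + \<int>\<close>.
\<close>

text \<open>
  The series is \<open>\<Sum>j\<ge>1. (1 - s)\<^bsup>j - 1\<^esup> x (j + a)\<close>, with \<open>j\<close> written as \<open>Suc m\<close>. Since \<open>suminf\<close> returns
  some value for a divergent series as well, convergence is a separate predicate.
\<close>

definition nabla_laplace_converges :: "real \<Rightarrow> (real \<Rightarrow> real) \<Rightarrow> complex \<Rightarrow> bool" where
  "nabla_laplace_converges a x s \<longleftrightarrow>
     summable (\<lambda>m. (1 - s) ^ m * complex_of_real (x (real (Suc m) + a)))"

definition nabla_laplace :: "real \<Rightarrow> (real \<Rightarrow> real) \<Rightarrow> complex \<Rightarrow> complex" where
  "nabla_laplace a x s =
     (\<Sum>m. (1 - s) ^ m * complex_of_real (x (real (Suc m) + a)))"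

definition nabla_diff :: "nat \<Rightarrow> (real \<Rightarrow> real) \<Rightarrow> real \<Rightarrow> real" where
  "nabla_diff n z k = (\<Sum>i=0..n. (-1) ^ i * real (n choose i) * z (k - real i))"

text \<open>
  The summation range is \<open>0 \<le> i \<le> k - a - 1\<close>, which is empty if \<open>k \<le> a\<close>; the floor only converts
  the integer-valued real \<open>k - a\<close> to type \<^typ>\<open>int\<close>.
\<close>

definition gl_diff :: "real \<Rightarrow> real \<Rightarrow> (real \<Rightarrow> real) \<Rightarrow> real \<Rightarrow> real" where
  "gl_diff a \<alpha> z k = (\<Sum>i<nat \<lfloor>k - a\<rfloor>. (-1) ^ i * (\<alpha> gchoose i) * z (k - real i))"

text \<open>
  For \<open>\<alpha> \<in> (n - 1, n)\<close> with \<open>n \<ge> 0\<close>, the number \<open>nat \<lceil>\<alpha>\<rceil>\<close> is \<open>n\<close>. The case \<open>n = 0\<close> gives the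
  Riemann--Liouville operator of order in \<open>(-1, 0)\<close>, which is the Gruenwald--Letnikov sum.
\<close>

definition rl_diff :: "real \<Rightarrow> real \<Rightarrow> (real \<Rightarrow> real) \<Rightarrow> real \<Rightarrow> real" where
  "rl_diff a \<alpha> z = nabla_diff (nat \<lceil>\<alpha>\<rceil>) (gl_diff a (\<alpha> - real (nat \<lceil>\<alpha>\<rceil>)) z)"

definition caputo_diff :: "real \<Rightarrow> real \<Rightarrow> (real \<Rightarrow> real) \<Rightarrow> real \<Rightarrow> real" where
  "caputo_diff a \<alpha> z = gl_diff a (\<alpha> - real (nat \<lceil>\<alpha>\<rceil>)) (nabla_diff (nat \<lceil>\<alpha>\<rceil>) z)"

text \<open>
  The tempered function \<open>(1 - lam)\<^bsup>k - a\<^esup>\<close> has an integer exponent that may be negative, and a base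
  that may be negative, so it is an integer power and not \<open>powr\<close>.
\<close>

definition tempering :: "real \<Rightarrow> real \<Rightarrow> real \<Rightarrow> real" where
  "tempering a lam k = (1 - lam) powi \<lfloor>k - a\<rfloor>"

definition tempered ::
    "real \<Rightarrow> real \<Rightarrow> ((real \<Rightarrow> real) \<Rightarrow> real \<Rightarrow> real) \<Rightarrow> (real \<Rightarrow> real) \<Rightarrow> real \<Rightarrow> real" where
  "tempered a lam D x k = inverse (tempering a lam k) * D (\<lambda>k'. tempering a lam k' * x k') k"

lemma nabla_diff_0: "nabla_diff 0 z = z"
  by (simp add: nabla_diff_def fun_eq_iff)

lemma nat_ceiling_order:
  assumes "real n - 1 < \<alpha>" "\<alpha> < real n"
  shows "nat \<lceil>\<alpha>\<rceil> = n"
proof -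
  have "\<lceil>\<alpha>\<rceil> = int n" using assms by (intro ceiling_unique) auto
  then show ?thesis by simp
qed

lemma rl_diff_eq:
  assumes "real n - 1 < \<alpha>" "\<alpha> < real n"
  shows "rl_diff a \<alpha> z = nabla_diff n (gl_diff a (\<alpha> - real n) z)"
  unfolding rl_diff_def nat_ceiling_order[OF assms] ..

lemma rl_diff_lower_eq:
  assumes "real n - 1 < \<alpha>" "\<alpha> < real n" "i < n"
  shows "rl_diff a (\<alpha> - real i - 1) z = nabla_diff (n - i - 1) (gl_diff a (\<alpha> - real n) z)"
proof -
  have n: "real (n - i - 1) = real n - real i - 1" using assms(3) by linarith
  show ?thesis
    using rl_diff_eq[of "n - i - 1" "\<alpha> - real i - 1" a z] assms by (simp only: n) simp
qed

lemma caputo_diff_eq: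
  assumes "real n - 1 < \<alpha>" "\<alpha> < real n"
  shows "caputo_diff a \<alpha> z = gl_diff a (\<alpha> - real n) (nabla_diff n z)"
  unfolding caputo_diff_def nat_ceiling_order[OF assms] ..

end

theory Submission
  imports Defs
begin

text \<open>
  Put \<open>z k = (1 - lam)\<^bsup>k - a\<^esup> x k\<close> and \<open>u = (s - lam) / (1 - lam)\<close>, so that \<open>1 - u = (1 - s) / (1 - lam)\<close>.
  Then the transform at \<open>s\<close> of a tempered operator applied to \<open>x\<close> is \<open>1 / (1 - lam)\<close> times the
  transform at \<open>u\<close> of the untempered operator applied to \<open>z\<close>. For untempered operators a backward
  difference multiplies the transform by \<open>u\<close> and subtracts the boundary value, and a
  Gruenwald--Letnikov sum is a convolution with the coefficients of the binomial series
  \<open>(1 - (1 - u)) powr \<alpha>\<close>, so it multiplies the transform by \<open>u powr \<alpha>\<close>.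
\<close>

section \<open>Absolute convergence of the transform\<close>

text \<open>Absolute convergence is the invariant carried through all operators: the Cauchy product
  requires it, and differences and fractional sums preserve it.\<close>

definition nabla_laplace_abs_converges :: "real \<Rightarrow> (real \<Rightarrow> real) \<Rightarrow> complex \<Rightarrow> bool" where
  "nabla_laplace_abs_converges a x s \<longleftrightarrow>
     summable (\<lambda>m. norm ((1 - s) ^ m * complex_of_real (x (real (Suc m) + a))))"

lemma nabla_laplace_abs_converges_imp_converges:
  "nabla_laplace_abs_converges a x s \<Longrightarrow> nabla_laplace_converges a x s"
  unfolding nabla_laplace_abs_converges_def nabla_laplace_converges_def
  by (rule summable_norm_cancel)

text \<open>The transform is a power series in \<open>1 - s\<close>, so convergence at the real
  point \<open>1 - \<rho>\<close>, farther from 1 than \<open>s\<close> but still in the disc,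
  forces absolute convergence at \<open>s\<close>.\<close>

lemma nabla_laplace_abs_converges_inside:
  assumes "\<And>t. norm (t - 1) < r \<Longrightarrow> nabla_laplace_converges a x t" and "norm (s - 1) < r"
  shows "nabla_laplace_abs_converges a x s"
proof -
  obtain \<rho> where \<rho>: "norm (s - 1) < \<rho>" "\<rho> < r"
    using assms(2) dense by blast
  have "0 \<le> \<rho>"
    using \<rho>(1) norm_ge_zero[of "s - 1"] by linarith
  have "nabla_laplace_converges a x (1 - of_real \<rho>)"
    using \<open>0 \<le> \<rho>\<close> \<rho> by (intro assms(1)) simp
  then have "summable (\<lambda>m. complex_of_real (x (real (Suc m) + a)) * of_real \<rho> ^ m)"
    unfolding nabla_laplace_converges_def by (simp add: mult.commute)
  moreover have "norm (1 - s) < norm (complex_of_real \<rho>)"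
    using \<rho> \<open>0 \<le> \<rho>\<close> by (simp add: norm_minus_commute)
  ultimately have "summable (\<lambda>m. norm (complex_of_real (x (real (Suc m) + a)) * (1 - s) ^ m))"
    by (rule powser_insidea)
  then show ?thesis
    unfolding nabla_laplace_abs_converges_def by (simp add: mult.commute)
qed

section \<open>Backward differences of integer order\<close>

text \<open>Pascal's rule splits the coefficients; its two halves give the two differences of order
  \<open>n\<close>.\<close>

lemma nabla_diff_Suc:
  "nabla_diff (Suc n) z k = nabla_diff n z k - nabla_diff n z (k - 1)"
proof -
  let ?f = "\<lambda>i. (-1) ^ i * z (k - real i)"
  have "nabla_diff (Suc n) z k = ?f 0 + (\<Sum>i\<le>n. real (Suc n choose Suc i) * ?f (Suc i))"
    unfolding nabla_diff_def atLeast0AtMost by (subst sum.atMost_Suc_shift) (simp add: ac_simps)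
  also have "(\<Sum>i\<le>n. real (Suc n choose Suc i) * ?f (Suc i)) =
      (\<Sum>i\<le>n. real (n choose i) * ?f (Suc i)) + (\<Sum>i\<le>n. real (n choose Suc i) * ?f (Suc i))"
    by (simp add: sum.distrib[symmetric] algebra_simps)
  also have "(\<Sum>i\<le>n. real (n choose i) * ?f (Suc i)) = - nabla_diff n z (k - 1)"
    unfolding nabla_diff_def atLeast0AtMost by (simp add: sum_negf[symmetric] algebra_simps)
  also have "?f 0 + (- nabla_diff n z (k - 1) + (\<Sum>i\<le>n. real (n choose Suc i) * ?f (Suc i))) =
      (\<Sum>i\<le>Suc n. real (n choose i) * ?f i) - nabla_diff n z (k - 1)"
    by (subst sum.atMost_Suc_shift) simp
  \<comment> \<open>The extra top term has coefficient \<open>n choose Suc n\<close>, which is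
    0.\<close>
  also have "(\<Sum>i\<le>Suc n. real (n choose i) * ?f i) = nabla_diff n z k"
    unfolding nabla_diff_def atLeast0AtMost by (simp add: ac_simps)
  finally show ?thesis .
qed

lemma nabla_laplace_backward_diff:
  assumes "nabla_laplace_abs_converges a z u"
  shows "nabla_laplace_abs_converges a (\<lambda>k. z k - z (k - 1)) u"
    and "nabla_laplace a (\<lambda>k. z k - z (k - 1)) u = u * nabla_laplace a z u - of_real (z a)"
proof -
  define f where "f m = (1 - u) ^ m * complex_of_real (z (real (Suc m) + a))" for m
  \<comment> \<open>\<open>g\<close> is the series of the shifted function: its head
    \<open>g 0\<close> is the value at \<open>a\<close>, which the transform of \<open>z\<close>
    does not see, and its tail is \<open>1 - u\<close> times \<open>f\<close>.\<close>
  define g where "g m = (1 - u) ^ m * complex_of_real (z (real m + a))" for m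
  have f: "summable (\<lambda>m. norm (f m))"
    using assms by (simp add: f_def nabla_laplace_abs_converges_def)
  have g_Suc: "g (Suc m) = (1 - u) * f m" for m
    by (simp add: f_def g_def)
  have "summable (\<lambda>m. norm (g (Suc m)))"
    unfolding g_Suc norm_mult by (intro summable_mult f)
  then have g: "summable (\<lambda>m. norm (g m))"
    by (subst (asm) summable_Suc_iff)
  have diff: "(1 - u) ^ m * complex_of_real (z (real (Suc m) + a) - z (real (Suc m) + a - 1)) = f m - g m"
    for m
    by (simp add: f_def g_def algebra_simps)
  have "summable (\<lambda>m. norm (f m - g m))"
    by (rule summable_comparison_test'[OF summable_add[OF f g], of 0]) (simp add: norm_triangle_ineq4)
  then show "nabla_laplace_abs_converges a (\<lambda>k. z k - z (k - 1)) u"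
    unfolding nabla_laplace_abs_converges_def diff .
  have "suminf g = g 0 + (\<Sum>m. g (Suc m))"
    using suminf_split_head[OF summable_norm_cancel[OF g]] by simp
  also have "\<dots> = of_real (z a) + (1 - u) * suminf f"
    unfolding g_Suc by (subst suminf_mult[OF summable_norm_cancel[OF f]]) (simp add: g_def)
  finally have "suminf f - suminf g = u * suminf f - of_real (z a)"
    by (simp add: algebra_simps)
  then show "nabla_laplace a (\<lambda>k. z k - z (k - 1)) u = u * nabla_laplace a z u - of_real (z a)"
    using suminf_diff[OF f[THEN summable_norm_cancel] g[THEN summable_norm_cancel]]
    unfolding nabla_laplace_def diff f_def[symmetric] by simp
qed

text \<open>Each further difference multiplies the earlier boundary terms by \<open>u\<close> and
  adds a new one with weight \<open>u ^ 0\<close>.\<close>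

lemma nabla_laplace_nabla_diff:
  assumes "nabla_laplace_abs_converges a z u"
  shows "nabla_laplace_abs_converges a (nabla_diff n z) u"
    and "nabla_laplace a (nabla_diff n z) u =
      u ^ n * nabla_laplace a z u - (\<Sum>i<n. u ^ (n - i - 1) * of_real (nabla_diff i z a))"
proof (induction n)
  case 0
  show "nabla_laplace_abs_converges a (nabla_diff 0 z) u"
    using assms by (simp add: nabla_diff_0)
  show "nabla_laplace a (nabla_diff 0 z) u =
      u ^ 0 * nabla_laplace a z u - (\<Sum>i<0. u ^ (0 - i - 1) * of_real (nabla_diff i z a))"
    by (simp add: nabla_diff_0)
next
  case (Suc n)
  have D: "nabla_diff (Suc n) z = (\<lambda>k. nabla_diff n z k - nabla_diff n z (k - 1))"
    by (simp add: fun_eq_iff nabla_diff_Suc)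
  show "nabla_laplace_abs_converges a (nabla_diff (Suc n) z) u"
    unfolding D by (rule nabla_laplace_backward_diff(1)[OF Suc.IH(1)])
  have "(\<Sum>i<n. u ^ (n - i) * of_real (nabla_diff i z a)) =
      u * (\<Sum>i<n. u ^ (n - i - 1) * complex_of_real (nabla_diff i z a))"
    unfolding sum_distrib_left
  proof (rule sum.cong[OF refl])
    fix i assume "i \<in> {..<n}"
    then have "n - i = Suc (n - i - 1)" by simp
    then have "u ^ (n - i) = u * u ^ (n - i - 1)" by (metis power_Suc)
    then show "u ^ (n - i) * complex_of_real (nabla_diff i z a) =
        u * (u ^ (n - i - 1) * complex_of_real (nabla_diff i z a))" by simp
  qed
  then show "nabla_laplace a (nabla_diff (Suc n) z) u =
      u ^ Suc n * nabla_laplace a z u -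
        (\<Sum>i<Suc n. u ^ (Suc n - i - 1) * of_real (nabla_diff i z a))"
    unfolding D nabla_laplace_backward_diff(2)[OF Suc.IH(1)] Suc.IH(2)
    by (simp add: algebra_simps)
qed

section \<open>Binomial series and Gruenwald-Letnikov sums\<close>

lemma of_real_gbinomial:
  "of_real (x gchoose k) = (of_real x gchoose k :: 'a :: {real_div_algebra, field_char_0})"
  by (simp add: gbinomial_prod_rev)

lemma summable_norm_gen_binomial:
  fixes \<beta> q :: complex
  assumes "norm q < 1"
  shows "summable (\<lambda>i. norm ((\<beta> gchoose i) * q ^ i))"
proof -
  obtain \<rho> where \<rho>: "norm q < \<rho>" "\<rho> < 1"
    using assms dense by blast
  then have "0 \<le> \<rho>"
    using norm_ge_zero[of q] by linarith
  then have "summable (\<lambda>i. (\<beta> gchoose i) * of_real \<rho> ^ i)"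
    using gen_binomial_complex[of "of_real \<rho>" \<beta>] \<rho> by (simp add: sums_iff)
  then show ?thesis
    by (rule powser_insidea) (use \<rho> \<open>0 \<le> \<rho>\<close> in simp)
qed

lemma nabla_laplace_gl_diff:
  assumes "nabla_laplace_abs_converges a z u" and "norm (1 - u) < 1"
  shows "nabla_laplace_abs_converges a (gl_diff a \<beta> z) u"
    and "nabla_laplace a (gl_diff a \<beta> z) u = u powr of_real \<beta> * nabla_laplace a z u"
proof -
  define f where "f m = (1 - u) ^ m * complex_of_real (z (real (Suc m) + a))" for m
  \<comment> \<open>The base \<open>u - 1\<close> absorbs the sign \<open>(-1) ^ i\<close> and makes
    \<open>c\<close> the binomial series of \<open>(1 + (u - 1)) powr \<beta>\<close>.\<close>
  define c where "c i = (complex_of_real \<beta> gchoose i) * (u - 1) ^ i" for i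
  have f: "summable (\<lambda>m. norm (f m))"
    using assms by (simp add: f_def nabla_laplace_abs_converges_def)
  have c: "summable (\<lambda>m. norm (c m))"
    unfolding c_def
    by (rule summable_norm_gen_binomial) (use assms(2) in \<open>simp add: norm_minus_commute\<close>)
  have c_sum: "suminf c = u powr of_real \<beta>"
    using gen_binomial_complex[of "u - 1" "of_real \<beta>"] assms(2)
    by (simp add: c_def[abs_def] sums_iff norm_minus_commute)
  have conv: "(1 - u) ^ m * complex_of_real (gl_diff a \<beta> z (real (Suc m) + a)) =
      (\<Sum>i\<le>m. c i * f (m - i))" for m
  proof -
    \<comment> \<open>The sum at \<open>m + 1 + a\<close> has exactly \<open>m + 1\<close> terms and
      reaches down to \<open>a + 1\<close>, so it is a full Cauchy coefficient and no boundary value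
      arises.\<close>
    have "nat \<lfloor>real (Suc m) + a - a\<rfloor> = Suc m"
      by (simp add: add.commute)
    then have "(1 - u) ^ m * complex_of_real (gl_diff a \<beta> z (real (Suc m) + a)) =
        (\<Sum>i\<le>m. (1 - u) ^ m * ((-1) ^ i * (complex_of_real \<beta> gchoose i) *
            of_real (z (real (Suc m) + a - real i))))"
      by (simp only: gl_diff_def lessThan_Suc_atMost sum_distrib_left of_real_sum of_real_mult
          of_real_gbinomial of_real_power of_real_minus of_real_1)
    also have "\<dots> = (\<Sum>i\<le>m. c i * f (m - i))"
    proof (rule sum.cong[OF refl])
      fix i assume "i \<in> {..m}"
      then have i: "i \<le> m" by simp
      have "(u - 1) ^ i = (-1) ^ i * (1 - u) ^ i"
        by (metis minus_diff_eq power_minus)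
      moreover have "(1 - u) ^ m = (1 - u) ^ i * (1 - u) ^ (m - i)"
        using i by (simp flip: power_add)
      moreover have "real (Suc (m - i)) + a = real (Suc m) + a - real i"
        using i by (simp add: of_nat_diff)
      ultimately show "(1 - u) ^ m * ((-1) ^ i * (complex_of_real \<beta> gchoose i) *
            of_real (z (real (Suc m) + a - real i))) = c i * f (m - i)"
        by (simp only: c_def f_def ac_simps)
    qed
    finally show ?thesis .
  qed
  show "nabla_laplace_abs_converges a (gl_diff a \<beta> z) u"
    unfolding nabla_laplace_abs_converges_def conv
  proof (rule summable_comparison_test')
    show "summable (\<lambda>m. \<Sum>i\<le>m. norm (c i) * norm (f (m - i)))"
      using summable_Cauchy_product[of "\<lambda>i. norm (c i)" "\<lambda>i. norm (f i)"] c f by simp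
    show "norm (norm (\<Sum>i\<le>m. c i * f (m - i))) \<le> (\<Sum>i\<le>m. norm (c i) * norm (f (m - i)))"
      if "m \<ge> 0" for m
      using norm_sum[of "\<lambda>i. c i * f (m - i)" "{..m}"] by (simp add: norm_mult)
  qed
  show "nabla_laplace a (gl_diff a \<beta> z) u = u powr of_real \<beta> * nabla_laplace a z u"
    unfolding nabla_laplace_def conv Cauchy_product[OF c f, symmetric] c_sum
    unfolding f_def ..
qed

section \<open>Tempering as a change of variable\<close>

lemma tempering_nonzero: "lam \<noteq> 1 \<Longrightarrow> tempering a lam k \<noteq> 0"
  by (simp add: tempering_def)

lemma tempered_at_start: "tempered a lam D x a = D (\<lambda>k. tempering a lam k * x k) a"
  by (simp add: tempered_def tempering_def)

text \<open>With the identity as \<open>D\<close>, the facts on tempered operators apply to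
  \<open>x\<close> itself.\<close>

lemma tempered_identity: "lam \<noteq> 1 \<Longrightarrow> tempered a lam (\<lambda>z. z) x = x"
  by (simp add: tempered_def tempering_nonzero fun_eq_iff)

text \<open>The weight at \<open>Suc m + a\<close> is \<open>(1 - lam) ^ Suc m\<close>. Dividing by
  it, \<open>m\<close> of the factors turn \<open>1 - s\<close> into \<open>1 - u\<close>, and the
  remaining one is the prefactor.\<close>

lemma nabla_laplace_tempered_term:
  fixes s :: complex
  assumes "lam \<noteq> 1"
  defines "u \<equiv> (s - of_real lam) / (1 - of_real lam)"
  shows "(1 - s) ^ m * complex_of_real (tempered a lam D x (real (Suc m) + a)) =
    1 / (1 - of_real lam) *
      ((1 - u) ^ m * of_real (D (\<lambda>k. tempering a lam k * x k) (real (Suc m) + a)))"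
proof -
  have nz: "(1 - complex_of_real lam) \<noteq> 0"
    using assms(1) by (metis eq_iff_diff_eq_0 of_real_1 of_real_eq_iff)
  have "1 - u = (1 - s) / (1 - of_real lam)"
    using nz by (simp add: u_def divide_simps)
  moreover
  have "tempering a lam (real (Suc m) + a) = (1 - lam) ^ Suc m"
  proof -
    have "\<lfloor>real (Suc m) + a - a\<rfloor> = int (Suc m)"
      by (simp add: add.commute)
    then show ?thesis
      by (simp only: tempering_def power_int_of_nat)
  qed
  then have "tempered a lam D x (real (Suc m) + a) =
      D (\<lambda>k. tempering a lam k * x k) (real (Suc m) + a) / (1 - lam) ^ Suc m"
    by (simp only: tempered_def divide_inverse mult.commute)
  ultimately show ?thesis
    by (simp add: power_divide del: of_nat_Suc)
qed

lemma nabla_laplace_tempered: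
  fixes s :: complex
  assumes "lam \<noteq> 1"
  defines "u \<equiv> (s - of_real lam) / (1 - of_real lam)"
  assumes "nabla_laplace_abs_converges a (D (\<lambda>k. tempering a lam k * x k)) u"
  shows "nabla_laplace_converges a (tempered a lam D x) s"
    and "nabla_laplace a (tempered a lam D x) s =
      1 / (1 - of_real lam) * nabla_laplace a (D (\<lambda>k. tempering a lam k * x k)) u"
proof -
  note conv = assms(3)[THEN nabla_laplace_abs_converges_imp_converges,
      unfolded nabla_laplace_converges_def]
  note eq = nabla_laplace_tempered_term[OF assms(1), of s, folded u_def]
  show "nabla_laplace_converges a (tempered a lam D x) s"
    unfolding nabla_laplace_converges_def eq by (intro summable_mult conv)
  show "nabla_laplace a (tempered a lam D x) s =
      1 / (1 - of_real lam) * nabla_laplace a (D (\<lambda>k. tempering a lam k * x k)) u"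
    unfolding nabla_laplace_def eq by (rule suminf_mult[OF conv])
qed

text \<open>For the identity operator the termwise identity can be read backwards, since a nonzero
  constant factor does not affect summability.\<close>

lemma nabla_laplace_abs_converges_tempering:
  fixes s :: complex
  assumes "lam \<noteq> 1" and "nabla_laplace_abs_converges a x s"
  shows "nabla_laplace_abs_converges a (\<lambda>k. tempering a lam k * x k)
    ((s - of_real lam) / (1 - of_real lam))"
proof -
  have "norm (1 / (1 - complex_of_real lam)) \<noteq> 0"
    using assms(1) by (metis divide_eq_0_iff eq_iff_diff_eq_0 norm_eq_zero of_real_1 of_real_eq_iff
        one_neq_zero)
  then show ?thesis
    using assms(2) unfolding nabla_laplace_abs_converges_def
    by (simp only: summable_cmult_iff norm_mult[of "1 / (1 - complex_of_real lam)"] simp_thms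
        nabla_laplace_tempered_term[OF assms(1), of s _ a "\<lambda>z. z" x,
          unfolded tempered_identity[OF assms(1)]])
qed

section \<open>Transforms of the tempered difference, Riemann-Liouville and Caputo operators\<close>

theorem theorem13:
  fixes a \<alpha> lam r :: real and n :: nat and x :: "real \<Rightarrow> real" and s :: complex
  assumes "n \<ge> 1"
    and "real n - 1 < \<alpha>" and "\<alpha> < real n"
    and "lam \<noteq> 1"
    and "r > 0"
    and "\<And>t. norm (t - 1) < r \<Longrightarrow> nabla_laplace_converges a x t"
    and "norm (s - 1) < min r \<bar>1 - lam\<bar>"
  shows
    "let u = (s - of_real lam) / (1 - of_real lam);
         X = nabla_laplace a x s
     in
       nabla_laplace_converges a (tempered a lam (nabla_diff n) x) s \<and>
       nabla_laplace a (tempered a lam (nabla_diff n) x) s =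
         u ^ n * X - 1 / (1 - of_real lam) *
           (\<Sum>i=0..n-1. u ^ i * of_real (tempered a lam (nabla_diff (n - i - 1)) x a)) \<and>
       nabla_laplace a (tempered a lam (nabla_diff n) x) s =
         u ^ n * X - 1 / (1 - of_real lam) *
           (\<Sum>i=0..n-1. u ^ (n - i - 1) * of_real (tempered a lam (nabla_diff i) x a)) \<and>
       nabla_laplace_converges a (tempered a lam (rl_diff a \<alpha>) x) s \<and>
       nabla_laplace a (tempered a lam (rl_diff a \<alpha>) x) s =
         u powr of_real \<alpha> * X - 1 / (1 - of_real lam) *
           (\<Sum>i=0..n-1. u ^ i * of_real (tempered a lam (rl_diff a (\<alpha> - real i - 1)) x a)) \<and>
       nabla_laplace_converges a (tempered a lam (caputo_diff a \<alpha>) x) s \<and>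
       nabla_laplace a (tempered a lam (caputo_diff a \<alpha>) x) s =
         u powr of_real \<alpha> * X - 1 / (1 - of_real lam) *
           (\<Sum>i=0..n-1. u powr of_real (\<alpha> - real i - 1) *
              of_real (tempered a lam (nabla_diff i) x a))"
proof -
  define u where "u = (s - of_real lam) / (1 - of_real lam)"
  define X where "X = nabla_laplace a x s"
  define z where "z = (\<lambda>k. tempering a lam k * x k)"
  define c where "c = 1 / (1 - complex_of_real lam)"
  have nz: "1 - complex_of_real lam \<noteq> 0"
    using assms(4) by (metis eq_iff_diff_eq_0 of_real_1 of_real_eq_iff)
  have "1 - u = (1 - s) / of_real (1 - lam)"
    using nz by (simp add: u_def divide_simps)
  \<comment> \<open>The bound of \<open>norm (s - 1)\<close> by the modulus of
    \<open>1 - lam\<close> puts \<open>u\<close> in the disc where the binomial series converges; in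
    particular \<open>u\<close> is nonzero, so exponents of its powers add.\<close>
  then have u: "norm (1 - u) < 1"
    using assms(4,7) by (simp only: norm_divide norm_of_real) (simp add: norm_minus_commute)
  then have u_nz: "u \<noteq> 0" by auto
  have x_abs: "nabla_laplace_abs_converges a x s"
    by (rule nabla_laplace_abs_converges_inside[OF assms(6)]) (use assms(7) in auto)
  have z_abs: "nabla_laplace_abs_converges a z u"
    using nabla_laplace_abs_converges_tempering[OF assms(4) x_abs] by (simp add: u_def z_def)
  have temp: "nabla_laplace_converges a (tempered a lam D x) s"
      "nabla_laplace a (tempered a lam D x) s = c * nabla_laplace a (D z) u"
    if "nabla_laplace_abs_converges a (D z) u" for D
    using nabla_laplace_tempered[OF assms(4), of a D x s] that by (simp_all add: u_def z_def c_def)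
  have start: "tempered a lam D x a = D z a" for D
    by (simp add: tempered_at_start z_def)
  \<comment> \<open>This turns the transform of \<open>z\<close> at \<open>u\<close> back into that
    of \<open>x\<close> at \<open>s\<close>: the prefactor \<open>c\<close> is absorbed in
    \<open>X\<close> and survives only on the boundary sums.\<close>
  have X: "X = c * nabla_laplace a z u"
    using temp(2)[of "\<lambda>z. z"] z_abs by (simp add: X_def tempered_identity[OF assms(4)])
  \<comment> \<open>Truncated subtraction makes this depend on \<open>n \<ge> 1\<close>.\<close>
  have range: "{0..n - 1} = {..<n}"
    using assms(1) by auto
  have reverse: "(\<Sum>i<n. u ^ i * complex_of_real (h (n - i - 1))) =
      (\<Sum>i<n. u ^ (n - i - 1) * complex_of_real (h i))" for h
    by (subst sum.nat_diff_reindex[symmetric]) (auto intro!: sum.cong)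

  note N = nabla_laplace_nabla_diff[OF z_abs, of n]
  have nab: "nabla_laplace a (tempered a lam (nabla_diff n) x) s =
      u ^ n * X - c * (\<Sum>i<n. u ^ (n - i - 1) * of_real (nabla_diff i z a))"
    by (simp add: temp(2)[of "nabla_diff n", OF N(1)] N(2) X algebra_simps)

  define \<beta> where "\<beta> = \<alpha> - real n"
  have powr_split: "u powr of_real \<beta> * u ^ m = u powr of_real (\<beta> + real m)" for m
    using u_nz by (simp add: powr_add powr_nat')
  note G = nabla_laplace_gl_diff[OF z_abs u, of \<beta>]
  \<comment> \<open>Here the differences act last, so the boundary values are those of the
    fractional sum and their weights stay integer powers of \<open>u\<close>.\<close>
  note R = nabla_laplace_nabla_diff[OF G(1), of n]
  have rl: "rl_diff a \<alpha> y = nabla_diff n (gl_diff a \<beta> y)" for y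
    using rl_diff_eq[OF assms(2,3)] by (simp add: \<beta>_def)
  \<comment> \<open>For \<open>i = n - 1\<close> the order lies in \<open>(-1, 0)\<close>, its
    ceiling is 0, and both sides are the plain fractional sum.\<close>
  have rl_lower: "rl_diff a (\<alpha> - real i - 1) y = nabla_diff (n - i - 1) (gl_diff a \<beta> y)"
    if "i < n" for i y
    using rl_diff_lower_eq[OF assms(2,3) that] by (simp add: \<beta>_def)
  have R_abs: "nabla_laplace_abs_converges a (rl_diff a \<alpha> z) u"
    using R(1) by (simp add: rl)
  have R_eq: "nabla_laplace a (rl_diff a \<alpha> z) u = u powr of_real \<alpha> * nabla_laplace a z u -
      (\<Sum>i<n. u ^ (n - i - 1) * of_real (nabla_diff i (gl_diff a \<beta> z) a))"
    unfolding rl R(2) G(2) using powr_split[of n] by (simp add: \<beta>_def mult_ac)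
  have rlt: "nabla_laplace a (tempered a lam (rl_diff a \<alpha>) x) s =
      u powr of_real \<alpha> * X -
        c * (\<Sum>i<n. u ^ i * of_real (nabla_diff (n - i - 1) (gl_diff a \<beta> z) a))"
    unfolding temp(2)[of "rl_diff a \<alpha>", OF R_abs] R_eq X
      reverse[of "\<lambda>i. nabla_diff i (gl_diff a \<beta> z) a"]
    by (simp add: algebra_simps)

  \<comment> \<open>Here the fractional sum acts last, so the factor \<open>u powr \<beta>\<close>
    also multiplies the boundary terms and shifts their exponents to
    \<open>\<alpha> - i - 1\<close>.\<close>
  note C = nabla_laplace_gl_diff[OF N(1) u, of \<beta>]
  have cap: "caputo_diff a \<alpha> y = gl_diff a \<beta> (nabla_diff n y)" for y
    using caputo_diff_eq[OF assms(2,3)] by (simp add: \<beta>_def)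
  have C_abs: "nabla_laplace_abs_converges a (caputo_diff a \<alpha> z) u"
    using C(1) by (simp add: cap)
  have "u powr of_real \<beta> * u ^ (n - i - 1) = u powr of_real (\<alpha> - real i - 1)" if "i < n" for i
  proof -
    have "\<beta> + real (n - i - 1) = \<alpha> - real i - 1"
      using that unfolding \<beta>_def by linarith
    then show ?thesis
      using powr_split[of "n - i - 1"] by simp
  qed
  then have "u powr of_real \<beta> * (\<Sum>i<n. u ^ (n - i - 1) * of_real (nabla_diff i z a)) =
      (\<Sum>i<n. u powr of_real (\<alpha> - real i - 1) * of_real (nabla_diff i z a))"
    by (simp add: sum_distrib_left mult.assoc[symmetric] del: of_real_diff)
  then have C_eq: "nabla_laplace a (caputo_diff a \<alpha> z) u = u powr of_real \<alpha> * nabla_laplace a z u -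
      (\<Sum>i<n. u powr of_real (\<alpha> - real i - 1) * of_real (nabla_diff i z a))"
    unfolding cap C(2) N(2) right_diff_distrib mult.assoc[symmetric] powr_split[of n]
    by (simp add: \<beta>_def del: of_real_diff)
  have capt: "nabla_laplace a (tempered a lam (caputo_diff a \<alpha>) x) s =
      u powr of_real \<alpha> * X -
        c * (\<Sum>i<n. u powr of_real (\<alpha> - real i - 1) * of_real (nabla_diff i z a))"
    unfolding temp(2)[of "caputo_diff a \<alpha>", OF C_abs] C_eq X by (simp add: algebra_simps)

  have "nabla_laplace a (tempered a lam (nabla_diff n) x) s =
      u ^ n * X - c * (\<Sum>i<n. u ^ i * of_real (nabla_diff (n - i - 1) z a))"
    unfolding nab reverse[of "\<lambda>i. nabla_diff i z a"] ..
  moreover have "(\<Sum>i<n. u ^ i * complex_of_real (rl_diff a (\<alpha> - real i - 1) z a)) =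
      (\<Sum>i<n. u ^ i * of_real (nabla_diff (n - i - 1) (gl_diff a \<beta> z) a))"
    by (intro sum.cong refl) (simp add: rl_lower)
  ultimately show ?thesis
    unfolding Let_def range start u_def[symmetric] X_def[symmetric] c_def[symmetric]
    using temp(1)[of "nabla_diff n", OF N(1)] temp(1)[of "rl_diff a \<alpha>", OF R_abs]
      temp(1)[of "caputo_diff a \<alpha>", OF C_abs] nab rlt capt
    by metis
qed

end
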